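(* Let $\mathbb{K}$ be an arbitrary field and let $k\geq 2$ be an integer. Then for every positive integer $n$, there exists a quadratic $\mathbb{K}$-algebra $R$ given by $n$ generators and $d_{n,k}$ relations such that $R$ is $k$-step nilpotent.
   Context: For a set $X$, $\mathbb{K}\langle X\rangle$ is the free associative $\mathbb{K}$-algebra generated by $X$. A quadratic $\mathbb{K}$-algebra given by $n$ generators and $d$ relations is an algebra $R=\mathbb{K}\langle X\rangle/I$, where $|X|=n$ and $I$ is the two-sided ideal of $\mathbb{K}\langle X\rangle$ generated by a collection of $d$ homogeneous elements of degree $2$ (the relations). Such an $R$ inherits the degree grading from $\mathbb{K}\langle X\rangle$; $R_q$ denotes its $q$-th homogeneous component. A graded algebra $R$ is called $k$-step nilpotent if $R_k=\{0\}$. For integers $n\geq 1$ and $k\geq 2$, $$d_{n,k}=\min_{n=a_1+\dots+a_{k-1}}\ \max_{1\leq j\leq k-1}(a_1+\dots+a_j)(a_j+\dots+a_{k-1}),$$ where the minimum is over all tuples $(a_1,\dots,a_{k-1})$ of non-negative integers with sum $n$. *)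

theory Defs
  imports "HOL-Algebra.QuotRing" "HOL-Algebra.Module" "HOL-Library.FuncSet"
begin

section \<open>Free associative algebras\<close>

text \<open>
  An element of the free algebra \<open>K\<langle>X\<rangle>\<close> is a finitely supported family of coefficients in \<open>K\<close>,
  indexed by the words over \<open>X\<close> (lists with entries in \<open>X\<close>). The coefficients at lists that are not
  words over \<open>X\<close> are required to be zero, so that equality of elements is equality of functions.
\<close>

definition free_alg_carrier :: "('a, 'm) ring_scheme \<Rightarrow> 'x set \<Rightarrow> ('x list \<Rightarrow> 'a) set"
  where "free_alg_carrier K X =
    {f. (\<forall>w. f w \<in> carrier K) \<and> (\<forall>w. w \<notin> lists X \<longrightarrow> f w = \<zero>\<^bsub>K\<^esub>) \<and> finite {w. f w \<noteq> \<zero>\<^bsub>K\<^esub>}}"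

text \<open>The factorizations of a word \<open>w\<close> are \<open>w = take i w @ drop i w\<close> for \<open>i \<le> length w\<close>.\<close>

definition free_alg_mult ::
  "('a, 'm) ring_scheme \<Rightarrow> ('x list \<Rightarrow> 'a) \<Rightarrow> ('x list \<Rightarrow> 'a) \<Rightarrow> ('x list \<Rightarrow> 'a)"
  where "free_alg_mult K f g =
    (\<lambda>w. \<Oplus>\<^bsub>K\<^esub>i\<in>{..length w}. f (take i w) \<otimes>\<^bsub>K\<^esub> g (drop i w))"

record ('a, 'b) graded_algebra = "('a, 'b) module" +
  hcomp :: "nat \<Rightarrow> 'b set"

definition free_algebra :: "('a, 'm) ring_scheme \<Rightarrow> 'x set \<Rightarrow> ('a, 'x list \<Rightarrow> 'a) graded_algebra"
  where "free_algebra K X =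
    \<lparr>carrier = free_alg_carrier K X,
     mult = free_alg_mult K,
     one = (\<lambda>w. if w = [] then \<one>\<^bsub>K\<^esub> else \<zero>\<^bsub>K\<^esub>),
     zero = (\<lambda>w. \<zero>\<^bsub>K\<^esub>),
     add = (\<lambda>f g w. f w \<oplus>\<^bsub>K\<^esub> g w),
     smult = (\<lambda>c f w. c \<otimes>\<^bsub>K\<^esub> f w),
     hcomp = (\<lambda>q. {f \<in> free_alg_carrier K X. \<forall>w. f w \<noteq> \<zero>\<^bsub>K\<^esub> \<longrightarrow> length w = q})\<rparr>"


section \<open>Quadratic algebras\<close>

text \<open>
  The quotient of a graded algebra by a two-sided ideal, extending the quotient ring of the library by
  the induced scalar multiplication and by the images of the homogeneous components. (The latter form
  a grading when the ideal is homogeneous, in particular when it is generated by homogeneous elements.)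
\<close>

definition quot_algebra ::
  "('a, 'b, 'm) graded_algebra_scheme \<Rightarrow> 'b set \<Rightarrow> ('a, 'b set) graded_algebra"
  where "quot_algebra A I =
    \<lparr>carrier = carrier (A Quot I),
     mult = mult (A Quot I),
     one = one (A Quot I),
     zero = zero (A Quot I),
     add = add (A Quot I),
     smult = (\<lambda>c C. \<Union>f\<in>C. I +>\<^bsub>A\<^esub> (c \<odot>\<^bsub>A\<^esub> f)),
     hcomp = (\<lambda>q. (\<lambda>f. I +>\<^bsub>A\<^esub> f) ` hcomp A q)\<rparr>"

definition quadratic_algebra ::
  "('a, 'm) ring_scheme \<Rightarrow> nat \<Rightarrow> nat \<Rightarrow> ('a, ('x list \<Rightarrow> 'a) set) graded_algebra \<Rightarrow> bool"
  where "quadratic_algebra K n d R \<longleftrightarrow>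
    (\<exists>(X :: 'x set) S. finite X \<and> card X = n \<and>
       finite S \<and> card S = d \<and> S \<subseteq> hcomp (free_algebra K X) 2 \<and>
       R = quot_algebra (free_algebra K X) (Idl\<^bsub>free_algebra K X\<^esub> S))"

definition step_nilpotent :: "nat \<Rightarrow> ('a, 'b, 'm) graded_algebra_scheme \<Rightarrow> bool"
  where "step_nilpotent k R \<longleftrightarrow> hcomp R k = {\<zero>\<^bsub>R\<^esub>}"


section \<open>The numbers \<open>d\<^sub>n\<^sub>,\<^sub>k\<close>\<close>

definition compositions :: "nat \<Rightarrow> nat \<Rightarrow> (nat \<Rightarrow> nat) set"
  where "compositions n m = {a \<in> {1..m} \<rightarrow>\<^sub>E UNIV. (\<Sum>i=1..m. a i) = n}"

definition d_num :: "nat \<Rightarrow> nat \<Rightarrow> nat"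
  where "d_num n k =
    (MIN a\<in>compositions n (k - 1). MAX j\<in>{1..k - 1}. (\<Sum>i=1..j. a i) * (\<Sum>i=j..k - 1. a i))"


section \<open>Well-definedness\<close>

lemma finite_compositions: "finite (compositions n m)"
proof (rule finite_subset)
  show "compositions n m \<subseteq> {1..m} \<rightarrow>\<^sub>E {..n}"
  proof
    fix a assume a: "a \<in> compositions n m"
    have "a i \<le> n" if "i \<in> {1..m}" for i
      using a member_le_sum[OF that, of a] by (auto simp: compositions_def)
    with a show "a \<in> {1..m} \<rightarrow>\<^sub>E {..n}" by (auto simp: compositions_def PiE_iff)
  qed
  show "finite ({1..m} \<rightarrow>\<^sub>E {..n})" by (intro finite_PiE) auto
qed

lemma compositions_nonempty:
  assumes "m \<ge> 1"
  shows "compositions n m \<noteq> {}"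
proof -
  have "(\<lambda>i\<in>{1..m}. if i = 1 then n else 0) \<in> compositions n m"
    using assms by (simp add: compositions_def)
  then show ?thesis by blast
qed

lemma free_alg_carrierD:
  assumes "f \<in> free_alg_carrier K X"
  shows "f w \<in> carrier K" "w \<notin> lists X \<Longrightarrow> f w = \<zero>\<^bsub>K\<^esub>" "finite {w. f w \<noteq> \<zero>\<^bsub>K\<^esub>}"
  using assms by (auto simp: free_alg_carrier_def)

context cring
begin

lemma free_alg_mult_Nil:
  assumes "\<And>w. f w \<in> carrier R" "\<And>w. g w \<in> carrier R"
  shows "free_alg_mult R f g [] = f [] \<otimes> g []"
  using assms by (simp add: free_alg_mult_def)

lemma free_alg_mult_Cons:
  assumes "\<And>w. f w \<in> carrier R" "\<And>w. g w \<in> carrier R"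
  shows "free_alg_mult R f g (x # w) =
    f [] \<otimes> g (x # w) \<oplus> free_alg_mult R (\<lambda>v. f (x # v)) g w"
proof -
  have "free_alg_mult R f g (x # w) =
    (\<Oplus>i\<in>{..length w}. f (take (Suc i) (x # w)) \<otimes> g (drop (Suc i) (x # w))) \<oplus> f [] \<otimes> g (x # w)"
    unfolding free_alg_mult_def length_Cons
    by (subst finsum_Suc2) (use assms in auto)
  also have "\<dots> = free_alg_mult R (\<lambda>v. f (x # v)) g w \<oplus> f [] \<otimes> g (x # w)"
    by (simp add: free_alg_mult_def)
  also have "\<dots> = f [] \<otimes> g (x # w) \<oplus> free_alg_mult R (\<lambda>v. f (x # v)) g w"
    using assms by (intro a_comm) (auto simp: free_alg_mult_def)
  finally show ?thesis .
qed

lemma free_alg_mult_in: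
  assumes "\<And>w. f w \<in> carrier R" "\<And>w. g w \<in> carrier R"
  shows "free_alg_mult R f g w \<in> carrier R"
  using assms by (simp add: free_alg_mult_def)

lemma free_alg_mult_l_distr:
  assumes "\<And>w. f w \<in> carrier R" "\<And>w. g w \<in> carrier R" "\<And>w. h w \<in> carrier R"
  shows "free_alg_mult R (\<lambda>w. f w \<oplus> g w) h w = free_alg_mult R f h w \<oplus> free_alg_mult R g h w"
proof -
  have "free_alg_mult R (\<lambda>w. f w \<oplus> g w) h w =
    (\<Oplus>i\<in>{..length w}. f (take i w) \<otimes> h (drop i w) \<oplus> g (take i w) \<otimes> h (drop i w))"
    unfolding free_alg_mult_def using assms by (intro finsum_cong') (auto simp: l_distr)
  also have "\<dots> = free_alg_mult R f h w \<oplus> free_alg_mult R g h w"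
    unfolding free_alg_mult_def using assms by (intro finsum_addf) auto
  finally show ?thesis .
qed

lemma free_alg_mult_r_distr:
  assumes "\<And>w. f w \<in> carrier R" "\<And>w. g w \<in> carrier R" "\<And>w. h w \<in> carrier R"
  shows "free_alg_mult R h (\<lambda>w. f w \<oplus> g w) w = free_alg_mult R h f w \<oplus> free_alg_mult R h g w"
proof -
  have "free_alg_mult R h (\<lambda>w. f w \<oplus> g w) w =
    (\<Oplus>i\<in>{..length w}. h (take i w) \<otimes> f (drop i w) \<oplus> h (take i w) \<otimes> g (drop i w))"
    unfolding free_alg_mult_def using assms by (intro finsum_cong') (auto simp: r_distr)
  also have "\<dots> = free_alg_mult R h f w \<oplus> free_alg_mult R h g w"
    unfolding free_alg_mult_def using assms by (intro finsum_addf) auto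
  finally show ?thesis .
qed

lemma free_alg_mult_smult_l:
  assumes "c \<in> carrier R" "\<And>w. f w \<in> carrier R" "\<And>w. g w \<in> carrier R"
  shows "free_alg_mult R (\<lambda>w. c \<otimes> f w) g w = c \<otimes> free_alg_mult R f g w"
proof -
  have "free_alg_mult R (\<lambda>w. c \<otimes> f w) g w =
    (\<Oplus>i\<in>{..length w}. c \<otimes> (f (take i w) \<otimes> g (drop i w)))"
    unfolding free_alg_mult_def using assms by (intro finsum_cong') (auto simp: m_assoc)
  also have "\<dots> = c \<otimes> free_alg_mult R f g w"
    unfolding free_alg_mult_def using assms by (intro finsum_rdistr[symmetric]) auto
  finally show ?thesis .
qed

lemma free_alg_mult_smult_r:
  assumes "c \<in> carrier R" "\<And>w. f w \<in> carrier R" "\<And>w. g w \<in> carrier R"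
  shows "free_alg_mult R f (\<lambda>w. c \<otimes> g w) w = c \<otimes> free_alg_mult R f g w"
proof -
  have "free_alg_mult R f (\<lambda>w. c \<otimes> g w) w =
    (\<Oplus>i\<in>{..length w}. c \<otimes> (f (take i w) \<otimes> g (drop i w)))"
    unfolding free_alg_mult_def using assms by (intro finsum_cong') (auto simp: m_lcomm)
  also have "\<dots> = c \<otimes> free_alg_mult R f g w"
    unfolding free_alg_mult_def using assms by (intro finsum_rdistr[symmetric]) auto
  finally show ?thesis .
qed

lemma free_alg_mult_assoc:
  assumes "\<And>w. f w \<in> carrier R" "\<And>w. g w \<in> carrier R" "\<And>w. h w \<in> carrier R"
  shows "free_alg_mult R (free_alg_mult R f g) h w = free_alg_mult R f (free_alg_mult R g h) w"
  using assms(1)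
proof (induction w arbitrary: f)
  case Nil
  then show ?case
    by (simp add: free_alg_mult_Nil free_alg_mult_in assms m_assoc)
next
  case (Cons x w)
  let ?f = "\<lambda>v. f (x # v)" and ?g = "\<lambda>v. g (x # v)"
  note C = Cons.prems assms(2,3) free_alg_mult_in
  have "free_alg_mult R (free_alg_mult R f g) h (x # w) =
    f [] \<otimes> g [] \<otimes> h (x # w) \<oplus>
    free_alg_mult R (\<lambda>v. f [] \<otimes> ?g v \<oplus> free_alg_mult R ?f g v) h w"
    by (simp add: free_alg_mult_Cons free_alg_mult_Nil C)
  also have "\<dots> = f [] \<otimes> g [] \<otimes> h (x # w) \<oplus>
    (f [] \<otimes> free_alg_mult R ?g h w \<oplus> free_alg_mult R (free_alg_mult R ?f g) h w)"
    by (simp add: free_alg_mult_l_distr free_alg_mult_smult_l C)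
  also have "free_alg_mult R (free_alg_mult R ?f g) h w = free_alg_mult R ?f (free_alg_mult R g h) w"
    by (rule Cons.IH) (rule Cons.prems)
  also have "f [] \<otimes> g [] \<otimes> h (x # w) \<oplus>
    (f [] \<otimes> free_alg_mult R ?g h w \<oplus> free_alg_mult R ?f (free_alg_mult R g h) w) =
    f [] \<otimes> (g [] \<otimes> h (x # w) \<oplus> free_alg_mult R ?g h w) \<oplus>
    free_alg_mult R ?f (free_alg_mult R g h) w"
    by (simp add: C r_distr m_assoc a_assoc)
  also have "\<dots> = free_alg_mult R f (free_alg_mult R g h) (x # w)"
    by (simp add: free_alg_mult_Cons C)
  finally show ?case .
qed

lemma free_alg_mult_carrier:
  assumes f: "f \<in> free_alg_carrier R X" and g: "g \<in> free_alg_carrier R X"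
  shows "free_alg_mult R f g \<in> free_alg_carrier R X"
proof -
  note D = free_alg_carrierD[OF f] free_alg_carrierD[OF g]
  have ex: "\<exists>u v. w = u @ v \<and> f u \<noteq> \<zero> \<and> g v \<noteq> \<zero>"
    if "free_alg_mult R f g w \<noteq> \<zero>" for w
  proof (rule ccontr)
    assume *: "\<not> ?thesis"
    have "f (take i w) = \<zero> \<or> g (drop i w) = \<zero>" for i
      using * by (metis append_take_drop_id)
    then have "f (take i w) \<otimes> g (drop i w) = \<zero>" for i
      using D(1,4) by (metis l_null r_null)
    then have "free_alg_mult R f g w = \<zero>" by (simp add: free_alg_mult_def)
    with that show False by simp
  qed
  have "w \<in> lists X" if "free_alg_mult R f g w \<noteq> \<zero>" for w
    using ex[OF that] D(2,5) by fastforce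
  moreover have "finite {w. free_alg_mult R f g w \<noteq> \<zero>}"
  proof (rule finite_subset)
    show "{w. free_alg_mult R f g w \<noteq> \<zero>} \<subseteq> (\<lambda>(u, v). u @ v) ` ({w. f w \<noteq> \<zero>} \<times> {w. g w \<noteq> \<zero>})"
      using ex by fastforce
    show "finite ((\<lambda>(u, v). u @ v) ` ({w. f w \<noteq> \<zero>} \<times> {w. g w \<noteq> \<zero>}))"
      using D(3,6) by blast
  qed
  ultimately show ?thesis
    using D(1,4) free_alg_mult_in[of f g] by (auto simp: free_alg_carrier_def)
qed

lemma free_alg_add_carrier:
  assumes f: "f \<in> free_alg_carrier R X" and g: "g \<in> free_alg_carrier R X"
  shows "(\<lambda>w. f w \<oplus> g w) \<in> free_alg_carrier R X"
proof -
  note D = free_alg_carrierD[OF f] free_alg_carrierD[OF g]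
  have "finite {w. f w \<oplus> g w \<noteq> \<zero>}"
    by (rule finite_subset[OF _ finite_UnI[OF D(3,6)]]) auto
  with D show ?thesis by (auto simp: free_alg_carrier_def)
qed

lemma free_alg_smult_carrier:
  assumes c: "c \<in> carrier R" and f: "f \<in> free_alg_carrier R X"
  shows "(\<lambda>w. c \<otimes> f w) \<in> free_alg_carrier R X"
proof -
  note D = free_alg_carrierD[OF f]
  have "finite {w. c \<otimes> f w \<noteq> \<zero>}"
    by (rule finite_subset[OF _ D(3)]) (use c in auto)
  with c D show ?thesis by (auto simp: free_alg_carrier_def)
qed

lemma free_alg_one_carrier: "(\<lambda>w. if w = [] then \<one> else \<zero>) \<in> free_alg_carrier R X"
proof -
  have "finite {w. (if w = [] then \<one> else \<zero>) \<noteq> \<zero>}"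
    by (rule finite_subset[of _ "{[]}"]) auto
  then show ?thesis by (auto simp: free_alg_carrier_def)
qed

lemma free_alg_one_l:
  assumes "\<And>w. f w \<in> carrier R"
  shows "free_alg_mult R (\<lambda>w. if w = [] then \<one> else \<zero>) f w = f w"
proof (cases w)
  case (Cons x v)
  have "free_alg_mult R (\<lambda>v. if x # v = [] then \<one> else \<zero>) f v = \<zero>"
    using assms by (simp add: free_alg_mult_def)
  with Cons assms show ?thesis by (simp add: free_alg_mult_Cons)
qed (use assms in \<open>simp add: free_alg_mult_Nil\<close>)

lemma free_alg_one_r:
  assumes "\<And>w. f w \<in> carrier R"
  shows "free_alg_mult R f (\<lambda>w. if w = [] then \<one> else \<zero>) w = f w"
  using assms
  by (induction w arbitrary: f) (simp_all add: free_alg_mult_Nil free_alg_mult_Cons)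

lemma free_algebra_ring: "ring (free_algebra R X)"
proof (rule ringI)
  show "abelian_group (free_algebra R X)"
  proof (rule abelian_groupI)
    fix f assume "f \<in> carrier (free_algebra R X)"
    then have f: "f \<in> free_alg_carrier R X" by (simp add: free_algebra_def)
    note D = free_alg_carrierD[OF f]
    have "(\<lambda>w. (\<ominus> \<one>) \<otimes> f w) \<in> free_alg_carrier R X"
      by (rule free_alg_smult_carrier) (use f in auto)
    then show "\<exists>g\<in>carrier (free_algebra R X). g \<oplus>\<^bsub>free_algebra R X\<^esub> f = \<zero>\<^bsub>free_algebra R X\<^esub>"
      by (intro bexI[of _ "\<lambda>w. (\<ominus> \<one>) \<otimes> f w"])
        (use D(1) in \<open>auto simp: free_algebra_def l_minus l_neg\<close>)
  next
    show "\<zero>\<^bsub>free_algebra R X\<^esub> \<in> carrier (free_algebra R X)"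
      by (simp add: free_algebra_def free_alg_carrier_def)
  qed (auto simp: free_algebra_def free_alg_add_carrier free_alg_carrierD a_ac)
  show "Group.monoid (free_algebra R X)"
    by (rule monoidI)
      (auto simp: free_algebra_def free_alg_mult_carrier free_alg_one_carrier free_alg_mult_assoc
        free_alg_one_l free_alg_one_r free_alg_carrierD)
qed (auto simp: free_algebra_def free_alg_mult_l_distr free_alg_mult_r_distr free_alg_carrierD)

lemma free_algebra_module: "module R (free_algebra R X)"
proof -
  interpret F: ring "free_algebra R X" by (rule free_algebra_ring)
  show ?thesis
    by (rule moduleI[OF is_cring F.is_abelian_group])
      (auto simp: free_algebra_def free_alg_smult_carrier free_alg_carrierD l_distr r_distr m_assoc)
qed

lemma free_algebra_smult_mult:
  assumes "c \<in> carrier R" "f \<in> carrier (free_algebra R X)" "g \<in> carrier (free_algebra R X)"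
  shows "c \<odot>\<^bsub>free_algebra R X\<^esub> (f \<otimes>\<^bsub>free_algebra R X\<^esub> g) =
      (c \<odot>\<^bsub>free_algebra R X\<^esub> f) \<otimes>\<^bsub>free_algebra R X\<^esub> g"
    and "c \<odot>\<^bsub>free_algebra R X\<^esub> (f \<otimes>\<^bsub>free_algebra R X\<^esub> g) =
      f \<otimes>\<^bsub>free_algebra R X\<^esub> (c \<odot>\<^bsub>free_algebra R X\<^esub> g)"
  using assms
  by (auto simp: free_algebra_def free_alg_mult_smult_l free_alg_mult_smult_r free_alg_carrierD)

lemma quot_algebra_ring:
  assumes "ideal I (free_algebra R X)"
  shows "ring (quot_algebra (free_algebra R X) I)"
proof -
  let ?A = "quot_algebra (free_algebra R X) I"
  interpret Q: ring "free_algebra R X Quot I" by (rule ideal.quotient_is_ring[OF assms])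
  have sel: "carrier ?A = carrier (free_algebra R X Quot I)"
    "mult ?A = mult (free_algebra R X Quot I)" "one ?A = one (free_algebra R X Quot I)"
    "zero ?A = zero (free_algebra R X Quot I)" "add ?A = add (free_algebra R X Quot I)"
    by (simp_all add: quot_algebra_def)
  show ?thesis
  proof (rule ringI)
    show "abelian_group ?A"
      by (rule abelian_groupI) (simp_all add: sel Q.a_ac Q.add.l_inv_ex)
    show "Group.monoid ?A"
      by (rule monoidI) (simp_all add: sel Q.m_assoc)
  qed (simp_all add: sel Q.l_distr Q.r_distr)
qed

lemma quot_algebra_smult:
  assumes I: "ideal I (free_algebra R X)"
    and c: "c \<in> carrier R" and f: "f \<in> carrier (free_algebra R X)"
  shows "c \<odot>\<^bsub>quot_algebra (free_algebra R X) I\<^esub> (I +>\<^bsub>free_algebra R X\<^esub> f) =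
    I +>\<^bsub>free_algebra R X\<^esub> (c \<odot>\<^bsub>free_algebra R X\<^esub> f)"
proof -
  let ?F = "free_algebra R X"
  interpret F: ring ?F by (rule free_algebra_ring)
  interpret M: module R ?F by (rule free_algebra_module)
  interpret I: ideal I ?F by (rule I)
  have cI: "c \<odot>\<^bsub>?F\<^esub> h \<in> I" if h: "h \<in> I" for h
  proof -
    have hF: "h \<in> carrier ?F" using h by (rule I.a_Hcarr)
    have "c \<odot>\<^bsub>?F\<^esub> h = (c \<odot>\<^bsub>?F\<^esub> \<one>\<^bsub>?F\<^esub>) \<otimes>\<^bsub>?F\<^esub> h"
      using free_algebra_smult_mult(1)[OF c F.one_closed hF] hF by simp
    then show ?thesis
      using I.I_l_closed[OF h M.smult_closed[OF c F.one_closed]] by simp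
  qed
  have "I +>\<^bsub>?F\<^esub> (c \<odot>\<^bsub>?F\<^esub> g) = I +>\<^bsub>?F\<^esub> (c \<odot>\<^bsub>?F\<^esub> f)" if g: "g \<in> I +>\<^bsub>?F\<^esub> f" for g
  proof -
    from g obtain h where h: "h \<in> I" and "g = h \<oplus>\<^bsub>?F\<^esub> f"
      by (auto simp: a_r_coset_def r_coset_def)
    then have "c \<odot>\<^bsub>?F\<^esub> g = c \<odot>\<^bsub>?F\<^esub> h \<oplus>\<^bsub>?F\<^esub> c \<odot>\<^bsub>?F\<^esub> f"
      using I.a_Hcarr[OF h] c f by (simp add: M.smult_r_distr)
    then have "c \<odot>\<^bsub>?F\<^esub> g \<in> I +>\<^bsub>?F\<^esub> (c \<odot>\<^bsub>?F\<^esub> f)"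
      using cI[OF h] by (auto simp: a_r_coset_def r_coset_def)
    then show ?thesis
      using I.a_repr_independence'[OF _ M.smult_closed[OF c f]] by simp
  qed
  moreover have "f \<in> I +>\<^bsub>?F\<^esub> f" by (rule I.a_rcos_self[OF f])
  ultimately have "(\<Union>g\<in>I +>\<^bsub>?F\<^esub> f. I +>\<^bsub>?F\<^esub> (c \<odot>\<^bsub>?F\<^esub> g)) = I +>\<^bsub>?F\<^esub> (c \<odot>\<^bsub>?F\<^esub> f)"
    by blast
  then show ?thesis by (simp add: quot_algebra_def)
qed

end

end

theory Submission
  imports Defs
begin

text \<open>
  Split the generators into blocks \<open>A\<^sub>1, \<dots>, A\<^bsub>k-1\<^esub>\<close> of sizes \<open>a\<^sub>1, \<dots>, a\<^bsub>k-1\<^esub>\<close> for an optimal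
  composition, and write \<open>t x = i\<close> for \<open>x \<in> A\<^sub>i\<close>. To a monomial \<open>x y\<close> with \<open>t y \<le> t x\<close> attach
  the interval \<open>[t y, t x]\<close>. Exactly \<open>(a\<^sub>1 + \<dots> + a\<^sub>j) (a\<^sub>j + \<dots> + a\<^bsub>k-1\<^esub>)\<close> of these intervals
  contain \<open>j\<close>, and interval graphs are perfect, so \<open>d\<^sub>n\<^sub>,\<^sub>k\<close> colours suffice to give overlapping
  intervals different colours. The relations are the sums of all monomials of one colour.

  Since \<open>1 \<le> t\<close> and \<open>t < k\<close>, every word \<open>x\<^sub>1 \<dots> x\<^sub>k\<close> has a position \<open>j\<close> with
  \<open>t x\<^bsub>j+1\<^esub> \<le> j \<le> t x\<^sub>j\<close>. Modulo the relation of its colour, \<open>x\<^sub>j x\<^bsub>j+1\<^esub>\<close> is a combination of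
  monomials whose intervals avoid \<open>j\<close>: the new type at position \<open>j\<close> either exceeds \<open>t x\<^sub>j\<close> or
  drops below \<open>j\<close>. Ordering the types at position \<open>j\<close> as \<open>j < \<dots> < k - 1\<close>, followed by all
  types below \<open>j\<close>, every rewriting step increases words lexicographically, so the process ends,
  and it can only end in \<open>0\<close>.
\<close>

section \<open>Colouring intervals\<close>

text \<open>Greedy colouring in order of left endpoints: whenever an interval is added, fewer than
  \<open>d\<close> colours are blocked.\<close>

lemma interval_colouring:
  fixes l r :: "'b \<Rightarrow> nat"
  assumes "finite P"
    and "\<And>p. p \<in> P \<Longrightarrow> l p \<le> r p"
    and "\<And>j. card {p \<in> P. l p \<le> j \<and> j \<le> r p} \<le> d"
  shows "\<exists>c. c ` P \<subseteq> {..<d} \<and>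
    (\<forall>p\<in>P. \<forall>q\<in>P. p \<noteq> q \<longrightarrow> c p = c q \<longrightarrow> r p < l q \<or> r q < l p)"
  using assms
proof (induction P rule: finite_ranking_induct[where f = l])
  case empty
  then show ?case by simp
next
  case (insert p P)
  show ?case
  \<comment> \<open>The induction rule allows \<open>p\<close> to lie in \<open>P\<close>
    already.\<close>
  proof (cases "p \<in> P")
    case True
    then have "insert p P = P" by blast
    with insert.IH insert.prems show ?thesis by simp
  next
    case False
    have "card {q \<in> P. l q \<le> j \<and> j \<le> r q} \<le> d" for j
      by (rule order_trans[OF card_mono insert.prems(2)[of j]]) (use insert.hyps(1) in auto)
    with insert.IH insert.prems(1) obtain c where c: "c ` P \<subseteq> {..<d}"
      "\<forall>p\<in>P. \<forall>q\<in>P. p \<noteq> q \<longrightarrow> c p = c q \<longrightarrow> r p < l q \<or> r q < l p"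
      by auto
    \<comment> \<open>As \<open>l p\<close> is maximal, all intervals meeting that of \<open>p\<close> contain \<open>l p\<close>.\<close>
    define N where "N = {q \<in> P. l q \<le> l p \<and> l p \<le> r q}"
    have "{q \<in> insert p P. l q \<le> l p \<and> l p \<le> r q} = insert p N"
      using insert.prems(1)[of p] by (auto simp: N_def)
    then have "card (insert p N) \<le> d"
      using insert.prems(2)[of "l p"] by simp
    moreover have "finite N" "p \<notin> N"
      using insert.hyps(1) False by (auto simp: N_def)
    ultimately have "card (c ` N) < card {..<d}"
      using card_image_le[of N c] by simp
    then have "\<not> {..<d} \<subseteq> c ` N"
      using \<open>finite N\<close> by (meson card_mono finite_imageI not_le)
    then obtain m where m: "m < d" "m \<notin> c ` N" by auto
    let ?c = "c(p := m)"
    \<comment> \<open>An interval outside \<open>N\<close> that starts no later than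
      \<open>l p\<close> must end before \<open>l p\<close>.\<close>
    have far: "r q < l p" if "q \<in> P" "c q = m" for q
      using that m insert.hyps(2)[of q] by (force simp: N_def)
    have "?c ` insert p P \<subseteq> {..<d}"
      using c(1) m by auto
    moreover have "\<forall>x\<in>insert p P. \<forall>y\<in>insert p P. x \<noteq> y \<longrightarrow> ?c x = ?c y \<longrightarrow> r x < l y \<or> r y < l x"
      using c(2) far by auto
    ultimately show ?thesis by blast
  qed
qed

section \<open>Monomials in ideals of the free algebra\<close>

definition free_monom :: "('a, 'm) ring_scheme \<Rightarrow> 'x list \<Rightarrow> 'x list \<Rightarrow> 'a"
  where "free_monom K u = (\<lambda>w. if w = u then \<one>\<^bsub>K\<^esub> else \<zero>\<^bsub>K\<^esub>)"

context cring
begin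

lemma free_monom_in [simp]: "free_monom R u w \<in> carrier R"
  by (simp add: free_monom_def)

lemma free_monom_carrier:
  assumes "u \<in> lists X"
  shows "free_monom R u \<in> free_alg_carrier R X"
proof -
  have "finite {w. free_monom R u w \<noteq> \<zero>}"
    by (rule finite_subset[of _ "{u}"]) (auto simp: free_monom_def)
  with assms show ?thesis by (auto simp: free_alg_carrier_def free_monom_def)
qed

lemma free_alg_mult_nonzero:
  assumes "\<And>w. f w \<in> carrier R" "\<And>w. g w \<in> carrier R" "free_alg_mult R f g w \<noteq> \<zero>"
  obtains u v where "w = u @ v" "f u \<noteq> \<zero>" "g v \<noteq> \<zero>"
proof -
  have "\<exists>i. f (take i w) \<noteq> \<zero> \<and> g (drop i w) \<noteq> \<zero>"
  proof (rule ccontr)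
    assume "\<not> ?thesis"
    then have "f (take i w) \<otimes> g (drop i w) = \<zero>" for i
      using assms(1,2) by (metis l_null r_null)
    with assms(3) show False by (simp add: free_alg_mult_def)
  qed
  then show ?thesis using that by (metis append_take_drop_id)
qed

lemma free_monom_mult_left:
  assumes "\<And>w. f w \<in> carrier R"
  shows "free_alg_mult R (free_monom R u) f (u @ w) = f w"
proof (induction u)
  case Nil
  then show ?case using assms by (simp add: free_monom_def free_alg_one_l)
next
  case (Cons x u)
  have "(\<lambda>v. free_monom R (x # u) (x # v)) = free_monom R u"
    by (auto simp: free_monom_def)
  with Cons assms show ?case
    by (simp add: free_alg_mult_Cons free_alg_mult_in) (simp add: free_monom_def assms)
qed

lemma free_monom_mult_right:
  assumes "\<And>w. f w \<in> carrier R"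
  shows "free_alg_mult R f (free_monom R u) (w @ u) = f w"
proof -
  \<comment> \<open>Only the cut right after \<open>w\<close> leaves \<open>u\<close> as second
    factor, so the convolution has a single term.\<close>
  have "(drop i (w @ u) = u) = (length w = i)" if "i \<le> length (w @ u)" for i
  proof
    assume "drop i (w @ u) = u"
    then have "length (drop i (w @ u)) = length u" by (rule arg_cong)
    then show "length w = i" using that by simp
  qed auto
  then have "free_alg_mult R f (free_monom R u) (w @ u) =
      (\<Oplus>i\<in>{..length (w @ u)}. if length w = i then f (take i (w @ u)) else \<zero>)"
    unfolding free_alg_mult_def by (intro finsum_cong') (auto simp: free_monom_def assms)
  also have "\<dots> = f (take (length w) (w @ u))"
    by (rule finsum_singleton) (auto simp: assms)
  finally show ?thesis by simp
qed

text \<open>Such an \<open>f\<close> is a finite linear combination of the monomials in its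
  support.\<close>

lemma in_ideal_if_monoms_in_ideal:
  assumes I: "ideal I (free_algebra R X)"
    and f: "f \<in> free_alg_carrier R X"
    and mon: "\<And>w. f w \<noteq> \<zero> \<Longrightarrow> free_monom R w \<in> I"
  shows "f \<in> I"
proof -
  interpret I: ideal I "free_algebra R X" by (rule I)
  \<comment> \<open>Induction over a finite superset \<open>W\<close> of the support makes it
    harmless that \<open>f u\<close> may vanish.\<close>
  have "f \<in> free_alg_carrier R X \<Longrightarrow> {w. f w \<noteq> \<zero>} \<subseteq> W \<Longrightarrow>
      (\<And>w. w \<in> W \<Longrightarrow> w \<in> lists X \<and> free_monom R w \<in> I) \<Longrightarrow> f \<in> I" if "finite W" for W
    using that
  proof (induction W arbitrary: f)
    case empty
    then have "f = \<zero>\<^bsub>free_algebra R X\<^esub>" by (auto simp: free_algebra_def)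
    then show ?case by simp
  next
    case (insert u W)
    note D = free_alg_carrierD[OF insert.prems(1)]
    \<comment> \<open>The scalar \<open>f u\<close> as a constant of the free algebra: scaling
      \<open>free_monom R u\<close> becomes a product that the ideal absorbs.\<close>
    let ?c = "\<lambda>w. if w = [] then f u else \<zero>"
    have u: "u \<in> lists X" "free_monom R u \<in> I" using insert.prems(3)[of u] by auto
    have c: "?c \<in> free_alg_carrier R X"
    proof -
      have "finite {w. ?c w \<noteq> \<zero>}" by (rule finite_subset[of _ "{[]}"]) auto
      then show ?thesis using D(1) by (auto simp: free_alg_carrier_def)
    qed
    have "finite {w. (f(u := \<zero>)) w \<noteq> \<zero>}"
      by (rule finite_subset[OF _ D(3)]) auto
    then have fu: "f(u := \<zero>) \<in> free_alg_carrier R X"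
      using D by (auto simp: free_alg_carrier_def)
    have "f(u := \<zero>) \<in> I"
      by (rule insert.IH[OF fu]) (use insert.prems(2,3) in \<open>auto split: if_splits\<close>)
    moreover have "free_alg_mult R ?c (free_monom R u) \<in> I"
      using I.I_l_closed[OF u(2), of ?c] c by (simp add: free_algebra_def)
    moreover have "f = (\<lambda>w. (f(u := \<zero>)) w \<oplus> free_alg_mult R ?c (free_monom R u) w)"
    proof
      fix w
      have "?c = (\<lambda>w. f u \<otimes> (if w = [] then \<one> else \<zero>))" using D(1) by auto
      then have "free_alg_mult R ?c (free_monom R u) w =
          free_alg_mult R (\<lambda>w. f u \<otimes> (if w = [] then \<one> else \<zero>)) (free_monom R u) w"
        by (rule arg_cong)
      also have "\<dots> = f u \<otimes> free_monom R u w"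
        by (subst free_alg_mult_smult_l) (auto simp: D(1) free_alg_one_l)
      finally have "free_alg_mult R ?c (free_monom R u) w = f u \<otimes> free_monom R u w" .
      then show "f w = (f(u := \<zero>)) w \<oplus> free_alg_mult R ?c (free_monom R u) w"
        using D(1) by (simp add: free_monom_def)
    qed
    ultimately show ?case
      using additive_subgroup.a_closed[OF I.additive_subgroup_axioms, of "f(u := \<zero>)" "free_alg_mult R ?c (free_monom R u)"]
      by (simp add: free_algebra_def)
  qed
  from this[OF free_alg_carrierD(3)[OF f] f] show ?thesis
    using mon free_alg_carrierD(2)[OF f] by blast
qed

text \<open>One rewriting step: modulo \<open>g\<close>, the word \<open>w\<close> is minus a
  combination of the other words of \<open>g\<close>.\<close>

lemma free_monom_in_ideal:
  assumes I: "ideal I (free_algebra R X)"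
    and g: "g \<in> I" "g w = \<one>"
    and mon: "\<And>v. v \<noteq> w \<Longrightarrow> g v \<noteq> \<zero> \<Longrightarrow> free_monom R v \<in> I"
    and w: "w \<in> lists X"
  shows "free_monom R w \<in> I"
proof -
  interpret I: ideal I "free_algebra R X" by (rule I)
  have gF: "g \<in> carrier (free_algebra R X)" using g(1) by (rule I.a_Hcarr)
  then have gc: "g \<in> free_alg_carrier R X" by (simp add: free_algebra_def)
  note D = free_alg_carrierD[OF gc]
  have mF: "free_monom R w \<in> carrier (free_algebra R X)"
    using free_monom_carrier[OF w] by (simp add: free_algebra_def)
  have "finite {v. (g(w := \<zero>)) v \<noteq> \<zero>}"
    by (rule finite_subset[OF _ D(3)]) auto
  then have hc: "g(w := \<zero>) \<in> free_alg_carrier R X"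
    using D by (auto simp: free_alg_carrier_def)
  have h: "g(w := \<zero>) \<in> I"
    by (rule in_ideal_if_monoms_in_ideal[OF I hc]) (use mon in \<open>auto split: if_splits\<close>)
  then have hF: "g(w := \<zero>) \<in> carrier (free_algebra R X)" by (rule I.a_Hcarr)
  have "g = free_monom R w \<oplus>\<^bsub>free_algebra R X\<^esub> g(w := \<zero>)"
    using D(1) g(2) by (auto simp: free_algebra_def free_monom_def)
  then have "free_monom R w = g \<ominus>\<^bsub>free_algebra R X\<^esub> g(w := \<zero>)"
    using mF hF by (metis I.add.inv_solve_right I.minus_eq gF)
  then show ?thesis
    using additive_subgroup.a_closed[OF I.additive_subgroup_axioms g(1)
        additive_subgroup.a_inv_closed[OF I.additive_subgroup_axioms h]] by (simp add: I.minus_eq)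
qed

text \<open>Take for \<open>g\<close> the product of the word \<open>u\<close>, \<open>f\<close> and
  the word \<open>v\<close>: a relation applied inside a longer word.\<close>

lemma free_alg_sandwich_in_ideal:
  assumes I: "ideal I (free_algebra R X)" and f: "f \<in> I"
    and u: "u \<in> lists X" and v: "v \<in> lists X"
  obtains g where "g \<in> I" "\<And>w. g (u @ w @ v) = f w"
    "\<And>z. g z \<noteq> \<zero> \<Longrightarrow> \<exists>w. z = u @ w @ v \<and> f w \<noteq> \<zero>"
proof
  interpret I: ideal I "free_algebra R X" by (rule I)
  let ?h = "free_alg_mult R f (free_monom R v)"
  let ?g = "free_alg_mult R (free_monom R u) ?h"
  have "f \<in> carrier (free_algebra R X)" using f by (rule I.a_Hcarr)
  then have fc: "f w \<in> carrier R" for w by (simp add: free_algebra_def free_alg_carrierD)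
  then have hc: "?h w \<in> carrier R" for w by (simp add: free_alg_mult_in)
  have "?h \<in> I"
    using I.I_r_closed[OF f, of "free_monom R v"] free_monom_carrier[OF v]
    by (simp add: free_algebra_def)
  then show "?g \<in> I"
    using I.I_l_closed[of ?h "free_monom R u"] free_monom_carrier[OF u]
    by (simp add: free_algebra_def)
  show "?g (u @ w @ v) = f w" for w
    by (simp add: free_monom_mult_left hc free_monom_mult_right fc)
  fix z assume "?g z \<noteq> \<zero>"
  then obtain z1 z2 where "z = z1 @ z2" "free_monom R u z1 \<noteq> \<zero>" "?h z2 \<noteq> \<zero>"
    by (rule free_alg_mult_nonzero[rotated 2]) (auto simp: hc)
  moreover from this(3) obtain w v' where "z2 = w @ v'" "f w \<noteq> \<zero>" "free_monom R v v' \<noteq> \<zero>"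
    by (rule free_alg_mult_nonzero[rotated 2]) (auto simp: fc)
  ultimately show "\<exists>w. z = u @ w @ v \<and> f w \<noteq> \<zero>"
    by (auto simp: free_monom_def split: if_splits)
qed

end

section \<open>Rewriting words\<close>

text \<open>A discrete intermediate value argument. With the first letter at position
  \<open>j\<close>, type minus position is nonnegative at the head and negative at the last letter,
  so it changes sign between two neighbours.\<close>

lemma descent_position:
  fixes t :: "'x \<Rightarrow> nat"
  assumes "w \<noteq> []" "j \<le> t (hd w)" "t (last w) + 1 < j + length w"
  shows "\<exists>u x y v. w = u @ x # y # v \<and> t y \<le> j + length u \<and> j + length u \<le> t x"
  using assms
proof (induction w arbitrary: j)
  case Nil
  then show ?case by simp
next
  case (Cons x w)
  show ?case
  proof (cases w)
    case Nil
    with Cons.prems show ?thesis by simp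
  next
    case w: (Cons y v)
    show ?thesis
    proof (cases "t y \<le> j")
      case True
      with w Cons.prems(2) show ?thesis by (intro exI[of _ "[]"]) auto
    next
      case False
      with w Cons.prems have "\<exists>u x y v. w = u @ x # y # v \<and>
          t y \<le> Suc j + length u \<and> Suc j + length u \<le> t x"
        by (intro Cons.IH) auto
      then obtain u x' y' v' where "w = u @ x' # y' # v'"
        "t y' \<le> Suc j + length u" "Suc j + length u \<le> t x'" by blast
      then show ?thesis
        by (intro exI[of _ "x # u"] exI[of _ x'] exI[of _ y'] exI[of _ v']) auto
    qed
  qed
qed

text \<open>The rank is the reverse of the order above: it decreases under rewriting.\<close>

fun word_rank :: "('x \<Rightarrow> nat) \<Rightarrow> nat \<Rightarrow> nat \<Rightarrow> 'x list \<Rightarrow> nat list"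
  where
    "word_rank t k j [] = []"
  | "word_rank t k j (x # w) = (if t x < j then 0 else k - t x) # word_rank t k (Suc j) w"

lemma length_word_rank [simp]: "length (word_rank t k j w) = length w"
  by (induction w arbitrary: j) auto

lemma word_rank_append:
  "word_rank t k j (u @ v) = word_rank t k j u @ word_rank t k (j + length u) v"
  by (induction u arbitrary: j) auto

text \<open>The entry of \<open>x\<close> is \<open>k - t x > 0\<close>. That of \<open>p\<close> is
  \<open>k - t p\<close> with \<open>t p > t x\<close> in the first case and 0 in the second, hence
  smaller; later entries do not affect the lexicographic comparison.\<close>

lemma word_rank_less:
  assumes "t x < k" "t y \<le> j + length u" "j + length u \<le> t x"
    and "t q \<le> t p" "t p < k" "t x < t q \<or> t p < t y"
  shows "(word_rank t k j (u @ p # q # v), word_rank t k j (u @ x # y # v)) \<in> lex less_than"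
  using assms by (auto simp: word_rank_append intro!: lex_append_leftI)

definition colour_relation ::
  "('a, 'm) ring_scheme \<Rightarrow> 'x set \<Rightarrow> ('x \<Rightarrow> nat) \<Rightarrow> ('x \<times> 'x \<Rightarrow> nat) \<Rightarrow> nat \<Rightarrow> 'x list \<Rightarrow> 'a"
  where "colour_relation K X t c m = (\<lambda>w.
    if \<exists>x\<in>X. \<exists>y\<in>X. w = [x, y] \<and> t y \<le> t x \<and> c (x, y) = m then \<one>\<^bsub>K\<^esub> else \<zero>\<^bsub>K\<^esub>)"

section \<open>Reducing words of length \<open>k\<close> modulo the colour relations\<close>

context cring
begin

lemma colour_relation_quadratic:
  assumes "finite X"
  shows "colour_relation R X t c m \<in> hcomp (free_algebra R X) 2"
proof -
  have "finite {w. colour_relation R X t c m w \<noteq> \<zero>}"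
    by (rule finite_subset[of _ "(\<lambda>(x, y). [x, y]) ` (X \<times> X)"])
      (use assms in \<open>auto simp: colour_relation_def\<close>)
  then show ?thesis
    by (auto simp: free_algebra_def free_alg_carrier_def colour_relation_def)
qed

text \<open>Every word of length \<open>k\<close> reduces to words of smaller rank, so no nonzero
  normal form remains.\<close>

lemma words_in_ideal_of_colour_relations:
  assumes I: "ideal I (free_algebra R X)"
    and t: "\<And>x. x \<in> X \<Longrightarrow> 1 \<le> t x \<and> t x < k"
    and c: "\<And>x y p q. \<lbrakk>x \<in> X; y \<in> X; p \<in> X; q \<in> X; t y \<le> t x; t q \<le> t p; c (x, y) = c (p, q);
      (x, y) \<noteq> (p, q)\<rbrakk> \<Longrightarrow> t x < t q \<or> t p < t y"
    and rel: "\<And>x y. \<lbrakk>x \<in> X; y \<in> X; t y \<le> t x\<rbrakk> \<Longrightarrow> colour_relation R X t c (c (x, y)) \<in> I"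
    and w: "w \<in> lists X" "length w = k" "k > 0"
  shows "free_monom R w \<in> I"
proof -
  \<comment> \<open>\<open>lex\<close> relates only lists of equal length, which makes it
    well-founded.\<close>
  have wf: "wf (inv_image (lex less_than) (word_rank t k 1))"
    by (intro wf_inv_image wf_lex wf_less_than)
  show ?thesis
    using w
  proof (induction w rule: wf_induct_rule[OF wf])
    case (1 w)
    then have "w \<noteq> []" by auto
    then have "hd w \<in> X" "last w \<in> X" using "1.prems"(1) by auto
    \<comment> \<open>Positions start at 1; the sign change comes from
      \<open>1 \<le> t (hd w)\<close> and \<open>t (last w) < k = length w\<close>.\<close>
    then obtain u x y v where w: "w = u @ x # y # v" and
      xy: "t y \<le> 1 + length u" "1 + length u \<le> t x"
      using descent_position[of w 1 t] \<open>w \<noteq> []\<close> t[of "hd w"] t[of "last w"] "1.prems"(2) by auto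
    have X: "u \<in> lists X" "v \<in> lists X" "x \<in> X" "y \<in> X" using "1.prems"(1) w by auto
    let ?r = "colour_relation R X t c (c (x, y))"
    have "?r \<in> I" using X xy by (intro rel) auto
    from free_alg_sandwich_in_ideal[OF I this X(1,2)] obtain g where g: "g \<in> I"
      "\<And>w. g (u @ w @ v) = ?r w" "\<And>z. g z \<noteq> \<zero> \<Longrightarrow> \<exists>w. z = u @ w @ v \<and> ?r w \<noteq> \<zero>"
      by blast
    show ?case
    proof (rule free_monom_in_ideal[OF I g(1) _ _ "1.prems"(1)])
      have "g w = ?r [x, y]" using g(2)[of "[x, y]"] w by simp
      also have "\<dots> = \<one>" using X xy by (auto simp: colour_relation_def)
      finally show "g w = \<one>" .
    next
      fix z assume z: "z \<noteq> w" "g z \<noteq> \<zero>"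
      then obtain p q where pq: "z = u @ [p, q] @ v" "p \<in> X" "q \<in> X" "t q \<le> t p"
        "c (p, q) = c (x, y)"
        using g(3)[of z] by (auto simp: colour_relation_def split: if_splits)
      with z(1) w have "(x, y) \<noteq> (p, q)" by auto
      then have "t x < t q \<or> t p < t y"
        using X pq xy by (intro c) auto
      then have "(word_rank t k 1 z, word_rank t k 1 w) \<in> lex less_than"
        using word_rank_less[of t x k y 1 u q p v] xy pq X t[of x] t[of p] w by simp
      then show "free_monom R z \<in> I"
        using "1.prems" pq X w by (intro "1.IH") auto
    qed
  qed
qed

lemma step_nilpotent_quot_algebra:
  assumes I: "ideal I (free_algebra R X)"
    and mon: "\<And>w. w \<in> lists X \<Longrightarrow> length w = k \<Longrightarrow> free_monom R w \<in> I"
  shows "step_nilpotent k (quot_algebra (free_algebra R X) I)"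
proof -
  let ?F = "free_algebra R X"
  interpret I: ideal I ?F by (rule I)
  have "I +>\<^bsub>?F\<^esub> f = I" if "f \<in> hcomp ?F k" for f
  proof -
    have f: "f \<in> free_alg_carrier R X" and len: "\<And>w. f w \<noteq> \<zero> \<Longrightarrow> length w = k"
      using that by (auto simp: free_algebra_def)
    have "free_monom R w \<in> I" if "f w \<noteq> \<zero>" for w
      using free_alg_carrierD(2)[OF f, of w] len[OF that] that by (intro mon) auto
    then have "f \<in> I" by (rule in_ideal_if_monoms_in_ideal[OF I f])
    then show ?thesis by (rule I.a_rcos_const)
  qed
  \<comment> \<open>The component is nonempty, so its image is exactly the zero coset.\<close>
  moreover have "\<zero>\<^bsub>?F\<^esub> \<in> hcomp ?F k"
    using I.zero_closed by (simp add: free_algebra_def)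
  ultimately show ?thesis
    by (force simp: step_nilpotent_def quot_algebra_def FactRing_def)
qed

end

section \<open>Blocks of generators\<close>

text \<open>Cut the generators into consecutive blocks of lengths \<open>a 1\<close>, ...,
  \<open>a m\<close> and let \<open>t\<close> number the blocks.\<close>

lemma composition_types:
  assumes "a \<in> compositions n m" and "m \<ge> 1"
  obtains t :: "nat \<Rightarrow> nat" where "\<And>x. x < n \<Longrightarrow> 1 \<le> t x \<and> t x \<le> m"
    "\<And>j. j \<in> {1..m} \<Longrightarrow> card {x \<in> {..<n}. t x \<le> j} = (\<Sum>i=1..j. a i)"
    "\<And>j. j \<in> {1..m} \<Longrightarrow> card {x \<in> {..<n}. j \<le> t x} = (\<Sum>i=j..m. a i)"
proof
  define s where "s j = (\<Sum>i=1..j. a i)" for j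
  \<comment> \<open>Block \<open>j\<close> ends at \<open>s j\<close>; taking the least index skips
    empty blocks.\<close>
  define t where "t x = (LEAST j. x < s j)" for x
  have sm: "s m = n" using assms by (simp add: s_def compositions_def)
  have mono: "s i \<le> s j" if "i \<le> j" for i j
    unfolding s_def using that by (intro sum_mono2) auto
  have le_iff: "t x \<le> j \<longleftrightarrow> x < s j" if "x < n" for x j
  proof
    assume "t x \<le> j"
    moreover have "x < s (t x)" unfolding t_def by (rule LeastI[of _ m]) (use that sm in simp)
    ultimately show "x < s j" using mono[of "t x" j] by simp
  qed (simp add: t_def Least_le)
  show "1 \<le> t x \<and> t x \<le> m" if "x < n" for x
    using le_iff[OF that, of 0] le_iff[OF that, of m] that sm by (auto simp: s_def)
  fix j assume j: "j \<in> {1..m}"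
  then have "s j \<le> n" using mono[of j m] sm by simp
  then have "{x \<in> {..<n}. t x \<le> j} = {..<s j}" by (auto simp: le_iff)
  then show "card {x \<in> {..<n}. t x \<le> j} = (\<Sum>i=1..j. a i)" by (simp add: s_def)
  have "{x \<in> {..<n}. j \<le> t x} = {s (j - 1)..<n}"
    using le_iff[of _ "j - 1"] j by force
  moreover have "s (j - 1) + (\<Sum>i=j..m. a i) = n"
  proof -
    have "{1..m} = {1..j - 1} \<union> {j..m}" using j by auto
    then have "s m = s (j - 1) + (\<Sum>i=j..m. a i)"
      unfolding s_def using j by (subst sum.union_disjoint[symmetric]) auto
    then show ?thesis using sm by simp
  qed
  ultimately show "card {x \<in> {..<n}. j \<le> t x} = (\<Sum>i=j..m. a i)" by simp
qed

section \<open>Construction of the algebra and count of its relations\<close>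

theorem theorem1p3:
  fixes K :: "('a, 'm) ring_scheme" and k n :: nat
  assumes "field K" and "k \<ge> 2" and "n \<ge> 1"
  shows "\<exists>R :: ('a, (nat list \<Rightarrow> 'a) set) graded_algebra.
    quadratic_algebra K n (d_num n k) R \<and> step_nilpotent k R"
proof -
  interpret field K by fact
  let ?m = "k - 1" and ?d = "d_num n k" and ?X = "{..<n}"
  let ?F = "free_algebra K ?X"
  interpret F: ring ?F by (rule free_algebra_ring)
  have m: "?m \<ge> 1" using assms(2) by simp
  let ?s = "\<lambda>a j. (\<Sum>i=1..j. a i) * (\<Sum>i=j..?m. a i)"
  have "?d \<in> (\<lambda>a. MAX j\<in>{1..?m}. ?s a j) ` compositions n ?m"
    unfolding d_num_def
    using compositions_nonempty[OF m, of n]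
    by (intro Min_in finite_imageI finite_compositions) blast
  then obtain a where a: "a \<in> compositions n ?m" and d: "?d = (MAX j\<in>{1..?m}. ?s a j)"
    by blast
  obtain t :: "nat \<Rightarrow> nat" where t: "\<And>x. x < n \<Longrightarrow> 1 \<le> t x \<and> t x \<le> ?m"
    "\<And>j. j \<in> {1..?m} \<Longrightarrow> card {x \<in> ?X. t x \<le> j} = (\<Sum>i=1..j. a i)"
    "\<And>j. j \<in> {1..?m} \<Longrightarrow> card {x \<in> ?X. j \<le> t x} = (\<Sum>i=j..?m. a i)"
    using composition_types[OF a m] by blast
  define P where "P = {(x, y). x < n \<and> y < n \<and> t y \<le> t x}"
  define E where "E j = {p \<in> P. t (snd p) \<le> j \<and> j \<le> t (fst p)}" for j
  have finP: "finite P" by (rule finite_subset[of _ "?X \<times> ?X"]) (auto simp: P_def)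
  have cardE: "card (E j) = ?s a j" if "j \<in> {1..?m}" for j
  proof -
    \<comment> \<open>The condition \<open>t y \<le> t x\<close> follows from
      \<open>t y \<le> j\<close> and \<open>j \<le> t x\<close>, so \<open>E j\<close> is a full
      product.\<close>
    have "E j = {x \<in> ?X. j \<le> t x} \<times> {x \<in> ?X. t x \<le> j}" by (auto simp: E_def P_def)
    then show ?thesis using t(2,3)[OF that] by (simp add: card_cartesian_product)
  qed
  have "card (E j) \<le> ?d" for j
  proof (cases "j \<in> {1..?m}")
    case True
    then show ?thesis unfolding cardE[OF True] d by (intro Max_ge) auto
  next
    case False
    then have "E j = {}" using t(1) by (force simp: E_def P_def)
    then show ?thesis by simp
  qed
  then have "\<exists>c. c ` P \<subseteq> {..<?d} \<and> (\<forall>p\<in>P. \<forall>q\<in>P. p \<noteq> q \<longrightarrow> c p = c q \<longrightarrow>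
      t (fst p) < t (snd q) \<or> t (fst q) < t (snd p))"
    using finP by (intro interval_colouring) (auto simp: P_def E_def)
  then obtain c where cP: "c ` P \<subseteq> {..<?d}" and c': "\<forall>p\<in>P. \<forall>q\<in>P. p \<noteq> q \<longrightarrow> c p = c q \<longrightarrow>
      t (fst p) < t (snd q) \<or> t (fst q) < t (snd p)"
    by (elim exE conjE)
  have c: "t (fst p) < t (snd q) \<or> t (fst q) < t (snd p)"
    if "p \<in> P" "q \<in> P" "p \<noteq> q" "c p = c q" for p q
    using c' that by (elim ballE) auto
  \<comment> \<open>Exactly \<open>?d\<close> relations are required. The intervals of a largest
    \<open>E j\<close> overlap pairwise, so they already use all \<open>?d\<close> colours.\<close>
  have surj: "c ` P = {..<?d}"
  proof -
    have "?d \<in> ?s a ` {1..?m}"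
      unfolding d using m by (intro Max_in) auto
    then obtain j where "j \<in> {1..?m}" "?d = ?s a j" by blast
    then have "card (E j) = ?d" using cardE by simp
    moreover have "inj_on c (E j)" by (rule inj_onI) (use c in \<open>fastforce simp: E_def\<close>)
    ultimately have "card (c ` E j) = card {..<?d}" by (simp add: card_image)
    then have "c ` E j = {..<?d}"
      using cP by (intro card_subset_eq) (auto simp: E_def)
    with cP show ?thesis by (auto simp: E_def)
  qed
  let ?r = "colour_relation K ?X t c"
  \<comment> \<open>As every colour occurs, it can be read off from the support of its
    relation.\<close>
  have "inj_on ?r {..<?d}"
  proof (rule inj_onI)
    fix i j assume ij: "i \<in> {..<?d}" "j \<in> {..<?d}" "?r i = ?r j"
    then obtain x y where xy: "(x, y) \<in> P" "c (x, y) = i" using surj by (metis imageE surj_pair)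
    then have "?r i [x, y] = \<one>\<^bsub>K\<^esub>" by (auto simp: colour_relation_def P_def)
    then have "?r j [x, y] \<noteq> \<zero>\<^bsub>K\<^esub>" using ij(3) by simp
    then show "i = j" using xy by (auto simp: colour_relation_def split: if_splits)
  qed
  then have cardS: "card (?r ` {..<?d}) = ?d" by (simp add: card_image)
  have S: "?r ` {..<?d} \<subseteq> hcomp ?F 2" using colour_relation_quadratic by auto
  then have SF: "?r ` {..<?d} \<subseteq> carrier ?F" by (auto simp: free_algebra_def)
  let ?I = "Idl\<^bsub>?F\<^esub> (?r ` {..<?d})"
  have I: "ideal ?I ?F" by (rule F.genideal_ideal[OF SF])
  have "quadratic_algebra K n ?d (quot_algebra ?F ?I)"
    unfolding quadratic_algebra_def
    by (rule exI[of _ ?X], rule exI[of _ "?r ` {..<?d}"]) (use cardS S in auto)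
  moreover have "step_nilpotent k (quot_algebra ?F ?I)"
  proof (rule step_nilpotent_quot_algebra[OF I])
    fix w assume w: "w \<in> lists ?X" "length w = k"
    show "free_monom K w \<in> ?I"
    proof (rule words_in_ideal_of_colour_relations[OF I _ _ _ w])
      show "1 \<le> t x \<and> t x < k" if "x \<in> ?X" for x using t(1)[of x] that assms(2) by auto
      show "t x < t q \<or> t p < t y"
        if "x \<in> ?X" "y \<in> ?X" "p \<in> ?X" "q \<in> ?X" "t y \<le> t x" "t q \<le> t p"
          "c (x, y) = c (p, q)" "(x, y) \<noteq> (p, q)" for x y p q
        using c[of "(x, y)" "(p, q)"] that by (auto simp: P_def)
      show "?r (c (x, y)) \<in> ?I" if "x \<in> ?X" "y \<in> ?X" "t y \<le> t x" for x y
        using F.genideal_self[OF SF] cP that by (force simp: P_def)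
      show "k > 0" using assms(2) by simp
    qed
  qed
  ultimately show ?thesis by blast
qed

end
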